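(* The numerical dispersion relation of the (modified) Crank–Nicolson scheme $$ \frac{i}{\tau}(u^{n+1}-u^n)=-\frac12\Delta(u^{n+1}+u^n)+\frac{\lambda}{4}\bigl(|u^n|^2+|u^{n+1}|^2\bigr)(u^{n+1}+u^n) $$ for the cubic nonlinear Schrödinger equation $iu_t+\Delta u=\lambda|u|^2u$ is given by $$ \tilde\omega=\frac{2}{\tau}\arctan\bigl((k^2+\lambda)\tau/2\bigr). $$
   Context: Here $\lambda=\pm1$, $i=\sqrt{-1}$, $\tau>0$ is the time step and $u^n$ approximates $u$ at time $n\tau$. The numerical dispersion relation of a time-stepping scheme is the relation between the wave number $k$ and the numerical angular frequency $\tilde\omega$ obtained by substituting the discrete plane wave solution $u^n=e^{i(kx-\tilde\omega n\tau)}$ into the scheme. *)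

theory Defs
  imports "HOL-Analysis.Analysis"
begin

text \<open>Sum of the pure second partial derivatives.  As usual for \<open>vector_derivative\<close>, the value
  is only meaningful where these derivatives exist; plane waves are smooth.\<close>

definition laplacian :: "('a::euclidean_space \<Rightarrow> complex) \<Rightarrow> 'a \<Rightarrow> complex" where
  "laplacian f x =
     (\<Sum>b\<in>Basis. vector_derivative
        (\<lambda>t. vector_derivative (\<lambda>s. f (x + s *\<^sub>R b)) (at t)) (at 0))"

definition crank_nicolson ::
    "real \<Rightarrow> real \<Rightarrow> (nat \<Rightarrow> 'a::euclidean_space \<Rightarrow> complex) \<Rightarrow> bool" where
  "crank_nicolson lam \<tau> u \<longleftrightarrow>
     (\<forall>n x. \<i> / of_real \<tau> * (u (Suc n) x - u n x) =
        - (1/2) * laplacian (\<lambda>y. u (Suc n) y + u n y) x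
        + of_real (lam / 4) * of_real ((cmod (u n x))\<^sup>2 + (cmod (u (Suc n) x))\<^sup>2)
          * (u (Suc n) x + u n x))"

definition plane_wave ::
    "real \<Rightarrow> 'a::euclidean_space \<Rightarrow> real \<Rightarrow> nat \<Rightarrow> 'a \<Rightarrow> complex" where
  "plane_wave \<tau> k \<omega> n x = exp (\<i> * of_real (k \<bullet> x - \<omega> * real n * \<tau>))"

text \<open>The scheme is an arbitrary predicate on time-discrete sequences of functions of \<open>x\<close>.  Since
  \<open>plane_wave \<tau> k \<omega>\<close> depends on \<open>\<omega>\<close> only modulo \<open>2 * pi / \<tau>\<close>, every such relation is
  \<open>2 * pi / \<tau>\<close>-periodic in \<open>\<omega>\<close>; no branch is selected here.\<close>

definition numerical_dispersion_relation ::
    "real \<Rightarrow> ((nat \<Rightarrow> 'a::euclidean_space \<Rightarrow> complex) \<Rightarrow> bool) \<Rightarrow> ('a \<times> real) set" where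
  "numerical_dispersion_relation \<tau> scheme = {(k, \<omega>). scheme (plane_wave \<tau> k \<omega>)}"

end

theory Submission
  imports Defs
begin

text \<open>Every plane wave has modulus one, so on plane waves the nonlinear factor
  \<open>\<bar>u\<^sup>n\<bar>\<^sup>2 + \<bar>u\<^sup>n\<^sup>+\<^sup>1\<bar>\<^sup>2\<close> is the constant \<open>2\<close> and the scheme becomes linear. A
  plane wave is an eigenfunction of the Laplacian with eigenvalue \<open>- \<bar>k\<bar>\<^sup>2\<close>, and one time step
  multiplies it by \<open>z = e\<^bsup>- \<i> \<omega> \<tau>\<^esup>\<close>. Dividing by the nonvanishing factor \<open>u\<^sup>n\<close> leaves the scalar
  condition \<open>(\<i> / \<tau>) (z - 1) = ((\<bar>k\<bar>\<^sup>2 + \<lambda>) / 2) (z + 1)\<close>, the same at every time level and at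
  every point.

  Pulling the half-step \<open>e\<^bsup>- \<i> \<omega> \<tau> / 2\<^esup>\<close> out of \<open>z - 1\<close> and \<open>z + 1\<close> turns this into the real equation
  \<open>sin (\<omega> \<tau> / 2) = a cos (\<omega> \<tau> / 2)\<close> with \<open>a = (\<bar>k\<bar>\<^sup>2 + \<lambda>) \<tau> / 2\<close>, that is, \<open>\<omega> \<tau> / 2\<close> equals
  \<open>arctan a\<close> up to a multiple of \<open>\<pi>\<close>. Since \<open>2 arctan a\<close> lies strictly between \<open>- \<pi>\<close> and \<open>\<pi>\<close>, the
  multiple is zero exactly on the branch \<open>- \<pi> < \<omega> \<tau> \<le> \<pi>\<close>.\<close>

lemma vector_derivative_exp_line:
  fixes c :: complex and p q :: real
  shows "vector_derivative (\<lambda>s. c * exp (\<i> * of_real (p + s * q))) (at t)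
       = \<i> * of_real q * c * exp (\<i> * of_real (p + t * q))"
proof (rule vector_derivative_at)
  have "((\<lambda>w. c * exp (\<i> * (of_real p + w * of_real q))) has_field_derivative
      \<i> * of_real q * c * exp (\<i> * (of_real p + of_real t * of_real q))) (at (of_real t))"
    by (auto intro!: derivative_eq_intros)
  from has_vector_derivative_real_field[OF this]
  show "((\<lambda>s. c * exp (\<i> * of_real (p + s * q))) has_vector_derivative
      \<i> * of_real q * c * exp (\<i> * of_real (p + t * q))) (at t)"
    by simp
qed

text \<open>The second derivative along a basis vector \<open>b\<close> multiplies the wave by
  \<open>(\<i> (k \<bullet> b))\<^sup>2\<close>, and the squares \<open>(k \<bullet> b)\<^sup>2\<close> sum to \<open>\<bar>k\<bar>\<^sup>2\<close>.\<close>

lemma laplacian_exp_inner: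
  fixes k x :: "'a::euclidean_space" and c :: complex
  shows "laplacian (\<lambda>y. c * exp (\<i> * of_real (k \<bullet> y))) x
       = - of_real ((norm k)\<^sup>2) * (c * exp (\<i> * of_real (k \<bullet> x)))"
proof -
  have "laplacian (\<lambda>y. c * exp (\<i> * of_real (k \<bullet> y))) x =
      (\<Sum>b\<in>Basis. - of_real ((k \<bullet> b)\<^sup>2) * (c * exp (\<i> * of_real (k \<bullet> x))))"
    unfolding laplacian_def inner_add_right inner_scaleR_right vector_derivative_exp_line
    by (intro sum.cong refl) (simp add: power2_eq_square algebra_simps)
  also have "\<dots> = - of_real (\<Sum>b\<in>Basis. (k \<bullet> b)\<^sup>2) * (c * exp (\<i> * of_real (k \<bullet> x)))"
    by (simp add: sum_distrib_right sum_negf)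
  also have "(\<Sum>b\<in>Basis. (k \<bullet> b)\<^sup>2) = (norm k)\<^sup>2"
    unfolding power2_norm_eq_inner euclidean_inner[of k k] by (simp only: power2_eq_square)
  finally show ?thesis .
qed

lemma plane_wave_separated:
  "plane_wave \<tau> k \<omega> n x = exp (- \<i> * of_real (\<omega> * real n * \<tau>)) * exp (\<i> * of_real (k \<bullet> x))"
  by (simp add: plane_wave_def algebra_simps flip: exp_add)

lemma plane_wave_Suc:
  "plane_wave \<tau> k \<omega> (Suc n) x = exp (- \<i> * of_real (\<omega> * \<tau>)) * plane_wave \<tau> k \<omega> n x"
  by (simp add: plane_wave_def algebra_simps flip: exp_add)

lemma cmod_plane_wave: "cmod (plane_wave \<tau> k \<omega> n x) = 1"
  unfolding plane_wave_def by (rule norm_exp_i_times)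

text \<open>The amplification factor \<open>z\<close> of a plane wave decides whether it solves the scheme: the
  wave itself cancels from the equation because it never vanishes.\<close>

lemma crank_nicolson_plane_wave_iff_amplification:
  fixes k :: "'a::euclidean_space" and \<omega> \<tau> lam :: real
  defines "z \<equiv> exp (- \<i> * of_real (\<omega> * \<tau>))"
  shows "crank_nicolson lam \<tau> (plane_wave \<tau> k \<omega>) \<longleftrightarrow>
    \<i> / of_real \<tau> * (z - 1) = of_real (((norm k)\<^sup>2 + lam) / 2) * (z + 1)"
    (is "_ \<longleftrightarrow> ?L = ?R")
proof -
  have lap: "laplacian (\<lambda>y. plane_wave \<tau> k \<omega> (Suc n) y + plane_wave \<tau> k \<omega> n y) x
      = - of_real ((norm k)\<^sup>2) * ((z + 1) * plane_wave \<tau> k \<omega> n x)" for n x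
  proof -
    let ?c = "(z + 1) * exp (- \<i> * of_real (\<omega> * real n * \<tau>))"
    have sum: "plane_wave \<tau> k \<omega> (Suc n) y + plane_wave \<tau> k \<omega> n y = ?c * exp (\<i> * of_real (k \<bullet> y))" for y
      unfolding plane_wave_Suc z_def[symmetric] unfolding plane_wave_separated
      by (simp only: distrib_right mult_1_left mult.assoc)
    show ?thesis
      unfolding sum laplacian_exp_inner by (simp only: plane_wave_separated mult.assoc)
  qed
  have lhs: "\<i> / of_real \<tau> * (z * w - w) = ?L * w" for w
    by (simp add: right_diff_distrib left_diff_distrib)
  have rhs: "- (1/2) * (- of_real ((norm k)\<^sup>2) * ((z + 1) * w))
      + of_real (lam / 4) * of_real (1\<^sup>2 + 1\<^sup>2) * (z * w + w) = ?R * w" for w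
    by (simp add: add_divide_distrib algebra_simps)
  have "crank_nicolson lam \<tau> (plane_wave \<tau> k \<omega>) \<longleftrightarrow>
      (\<forall>n x. ?L * plane_wave \<tau> k \<omega> n x = ?R * plane_wave \<tau> k \<omega> n x)"
    unfolding crank_nicolson_def lap cmod_plane_wave
    unfolding plane_wave_Suc z_def[symmetric] lhs rhs ..
  also have "\<dots> \<longleftrightarrow> ?L = ?R"
  proof -
    have "plane_wave \<tau> k \<omega> n x \<noteq> 0" for n x
      by (simp add: plane_wave_def)
    then show ?thesis
      unfolding mult_cancel_right by blast
  qed
  finally show ?thesis .
qed

text \<open>For \<open>z = e\<^bsup>-2 \<i> \<theta>\<^esup>\<close> the Cayley transform \<open>\<i> (z - 1) / (z + 1)\<close> is the tangent of
  \<open>\<theta>\<close>. The form without quotients also covers \<open>z = - 1\<close>, where the cosine vanishes.\<close>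

lemma cayley_eq_iff_sin_cos:
  fixes \<theta> a :: real
  shows "\<i> * (exp (- \<i> * of_real (2 * \<theta>)) - 1) = of_real a * (exp (- \<i> * of_real (2 * \<theta>)) + 1)
    \<longleftrightarrow> sin \<theta> = a * cos \<theta>"
proof -
  let ?h = "exp (- \<i> * of_real \<theta>)"
  have h: "?h = of_real (cos \<theta>) - \<i> * of_real (sin \<theta>)"
    using cis_conv_exp[of "- \<theta>"] by (simp add: complex_eq_iff)
  have g: "exp (\<i> * of_real \<theta>) = of_real (cos \<theta>) + \<i> * of_real (sin \<theta>)"
    using cis_conv_exp[of \<theta>] by (simp add: complex_eq_iff)
  have one: "?h * exp (\<i> * of_real \<theta>) = 1" and sq: "exp (- \<i> * of_real (2 * \<theta>)) = ?h * ?h"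
    by (simp_all add: algebra_simps flip: exp_add)
  \<comment> \<open>Writing \<open>1\<close> as \<open>e\<^bsup>- \<i> \<theta>\<^esup> e\<^bsup>\<i> \<theta>\<^esup>\<close> exposes the half-step as a common factor.\<close>
  have minus: "exp (- \<i> * of_real (2 * \<theta>)) - 1 = ?h * (- 2 * \<i> * of_real (sin \<theta>))"
    unfolding sq one[symmetric] g right_diff_distrib[symmetric] by (subst (2) h) simp
  have plus: "exp (- \<i> * of_real (2 * \<theta>)) + 1 = ?h * (2 * of_real (cos \<theta>))"
    unfolding sq one[symmetric] g distrib_left[symmetric] by (subst (2) h) simp
  have "\<i> * (exp (- \<i> * of_real (2 * \<theta>)) - 1) = of_real a * (exp (- \<i> * of_real (2 * \<theta>)) + 1)
      \<longleftrightarrow> ?h * (2 * of_real (sin \<theta>)) = ?h * (2 * of_real (a * cos \<theta>))"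
    unfolding minus plus by (simp add: algebra_simps)
  also have "\<dots> \<longleftrightarrow> complex_of_real (sin \<theta>) = of_real (a * cos \<theta>)"
    by simp
  also have "\<dots> \<longleftrightarrow> sin \<theta> = a * cos \<theta>"
    by (simp only: of_real_eq_iff)
  finally show ?thesis .
qed

text \<open>Multiplying by \<open>cos (arctan a) > 0\<close> turns the difference of the two sides into
  \<open>sin (\<theta> - arctan a)\<close>, whose zeros are the multiples of \<open>\<pi>\<close>.\<close>

lemma sin_eq_mult_cos_iff:
  fixes \<theta> a :: real
  shows "sin \<theta> = a * cos \<theta> \<longleftrightarrow> (\<exists>m::int. \<theta> = arctan a + of_int m * pi)"
proof -
  have c: "cos (arctan a) \<noteq> 0"
    by (rule cos_arctan_not_zero)
  have s: "sin (arctan a) = a * cos (arctan a)"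
    using tan_arctan[of a] c by (simp add: tan_def field_simps)
  have "sin (\<theta> - arctan a) = cos (arctan a) * (sin \<theta> - a * cos \<theta>)"
    unfolding sin_diff s by (simp add: algebra_simps)
  then have "sin \<theta> = a * cos \<theta> \<longleftrightarrow> sin (\<theta> - arctan a) = 0"
    using c by simp
  also have "\<dots> \<longleftrightarrow> (\<exists>m::int. \<theta> = arctan a + of_int m * pi)"
    by (simp add: sin_zero_iff_int2 algebra_simps)
  finally show ?thesis .
qed

lemma crank_nicolson_plane_wave_iff:
  fixes k :: "'a::euclidean_space"
  assumes "\<tau> > 0"
  shows "crank_nicolson lam \<tau> (plane_wave \<tau> k \<omega>) \<longleftrightarrow>
    (\<exists>m::int. \<omega> = 2 / \<tau> * arctan (((norm k)\<^sup>2 + lam) * \<tau> / 2) + 2 * pi * of_int m / \<tau>)"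
proof -
  define \<theta> where "\<theta> = \<omega> * \<tau> / 2"
  define a where "a = ((norm k)\<^sup>2 + lam) * \<tau> / 2"
  define z where "z = exp (- \<i> * of_real (2 * \<theta>))"
  have z: "exp (- \<i> * of_real (\<omega> * \<tau>)) = z"
    by (simp add: z_def \<theta>_def)
  have a: "((norm k)\<^sup>2 + lam) / 2 = a / \<tau>"
    using assms by (simp add: a_def)
  have "crank_nicolson lam \<tau> (plane_wave \<tau> k \<omega>) \<longleftrightarrow>
      \<i> / of_real \<tau> * (z - 1) = of_real (a / \<tau>) * (z + 1)"
    unfolding crank_nicolson_plane_wave_iff_amplification z a ..
  also have "\<dots> \<longleftrightarrow> \<i> * (z - 1) = of_real a * (z + 1)"
    using assms by (simp add: divide_simps)
  also have "\<dots> \<longleftrightarrow> (\<exists>m::int. \<theta> = arctan a + of_int m * pi)"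
    unfolding z_def cayley_eq_iff_sin_cos sin_eq_mult_cos_iff ..
  also have "\<dots> \<longleftrightarrow> (\<exists>m::int. \<omega> = 2 / \<tau> * arctan a + 2 * pi * of_int m / \<tau>)"
    using assms by (simp add: \<theta>_def field_simps)
  finally show ?thesis
    unfolding a_def .
qed

text \<open>The angle \<open>2 arctan a\<close> itself lies in the half-open interval of length \<open>2 \<pi>\<close>, so any nonzero
  shift by a multiple of \<open>2 \<pi>\<close> leaves it.\<close>

lemma principal_branch_unique:
  fixes m :: int
  assumes "- pi < 2 * arctan a + 2 * pi * of_int m" "2 * arctan a + 2 * pi * of_int m \<le> pi"
  shows "m = 0"
proof -
  have "pi * of_int m < pi * 1" "pi * (- 1) < pi * of_int m"
    using assms arctan_lbound[of a] arctan_ubound[of a] by linarith+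
  then have "of_int m < (1::real)" "(- 1::real) < of_int m"
    using mult_less_cancel_left_pos[OF pi_gt_zero] by blast+
  then show ?thesis
    by linarith
qed

theorem lemma6p1:
  fixes lam \<tau> :: real
  assumes "lam = 1 \<or> lam = -1" and "\<tau> > 0"
  shows "\<forall>(k::'a::euclidean_space) \<omega>.
    ((k, \<omega>) \<in> numerical_dispersion_relation \<tau> (crank_nicolson lam \<tau>) \<longleftrightarrow>
       (\<exists>m::int. \<omega> = 2 / \<tau> * arctan (((norm k)\<^sup>2 + lam) * \<tau> / 2) + 2 * pi * of_int m / \<tau>)) \<and>
    ((k, \<omega>) \<in> numerical_dispersion_relation \<tau> (crank_nicolson lam \<tau>) \<and>
       - pi < \<omega> * \<tau> \<and> \<omega> * \<tau> \<le> pi \<longleftrightarrow>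
     \<omega> = 2 / \<tau> * arctan (((norm k)\<^sup>2 + lam) * \<tau> / 2))"
proof (intro allI)
  fix k :: 'a and \<omega> :: real
  let ?D = "numerical_dispersion_relation \<tau> (crank_nicolson lam \<tau>) :: ('a \<times> real) set"
  define a where "a = ((norm k)\<^sup>2 + lam) * \<tau> / 2"
  have rel: "(k, \<omega>) \<in> ?D \<longleftrightarrow> (\<exists>m::int. \<omega> = 2 / \<tau> * arctan a + 2 * pi * of_int m / \<tau>)"
    unfolding numerical_dispersion_relation_def a_def
    by (simp add: crank_nicolson_plane_wave_iff[OF assms(2)])
  have branch: "(k, \<omega>) \<in> ?D \<and> - pi < \<omega> * \<tau> \<and> \<omega> * \<tau> \<le> pi \<longleftrightarrow> \<omega> = 2 / \<tau> * arctan a"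
  proof
    assume *: "(k, \<omega>) \<in> ?D \<and> - pi < \<omega> * \<tau> \<and> \<omega> * \<tau> \<le> pi"
    then obtain m :: int where m: "\<omega> = 2 / \<tau> * arctan a + 2 * pi * of_int m / \<tau>"
      using rel by blast
    then have "\<omega> * \<tau> = 2 * arctan a + 2 * pi * of_int m"
      using assms(2) by (simp add: field_simps)
    then have "m = 0"
      using * principal_branch_unique[of a m] by simp
    then show "\<omega> = 2 / \<tau> * arctan a"
      using m by simp
  next
    assume \<omega>: "\<omega> = 2 / \<tau> * arctan a"
    then have "\<omega> * \<tau> = 2 * arctan a"
      using assms(2) by simp
    moreover have "(k, \<omega>) \<in> ?D"
      unfolding rel using \<omega> by (intro exI[of _ 0]) simp
    ultimately show "(k, \<omega>) \<in> ?D \<and> - pi < \<omega> * \<tau> \<and> \<omega> * \<tau> \<le> pi"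
      using arctan_lbound[of a] arctan_ubound[of a] by linarith
  qed
  show "((k, \<omega>) \<in> ?D \<longleftrightarrow>
       (\<exists>m::int. \<omega> = 2 / \<tau> * arctan (((norm k)\<^sup>2 + lam) * \<tau> / 2) + 2 * pi * of_int m / \<tau>)) \<and>
    ((k, \<omega>) \<in> ?D \<and> - pi < \<omega> * \<tau> \<and> \<omega> * \<tau> \<le> pi \<longleftrightarrow>
     \<omega> = 2 / \<tau> * arctan (((norm k)\<^sup>2 + lam) * \<tau> / 2))"
    using rel branch unfolding a_def by (rule conjI)
qed

end
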